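(* Let $\mathcal G:\mathscr P_2(\mathbb R^d)\to\mathbb R$ be convex along plans and locally Lipschitz around $\mu\in\mathscr P_2(\mathbb R^d)$. Then $$\mu\in\operatorname{argmin}\mathcal G\iff0\in\partial_C\mathcal G(\mu).$$
   Context: $\mathscr P_2(\mathbb R^d)$ is the space of Borel probability measures on $\mathbb R^d$ with finite second moment, with the 2-Wasserstein distance; $\Gamma(\mu,\nu)$ is the set of all couplings; $L^2_\mu$ is the space of $\mu$-square-integrable maps $\mathbb R^d\to\mathbb R^d$ with inner product $\langle\cdot,\cdot\rangle_\mu$. $\operatorname{argmin}\mathcal G$ is the set of global minimizers of $\mathcal G$ on $\mathscr P_2(\mathbb R^d)$. Convex along plans: for all $\mu,\nu\in\mathscr P_2(\mathbb R^d)$, all $\gamma\in\Gamma(\mu,\nu)$ and all $t\in[0,1]$, $\mathcal G(((1-t)\pi^1+t\pi^2)_\#\gamma)\le(1-t)\mathcal G(\mu)+t\mathcal G(\nu)$. Clarke subdifferential: let $C_1(\mathbb R^d;\mathbb R^d)$ be the set of continuous maps $w$ with $\sup_x|w(x)|/(1+|x|)<\infty$; $D\mathcal G(\mu)(w):=\limsup_{\nu\to\mu,\ t\searrow0}\frac{\mathcal G((\mathrm{id}+tw)_\#\nu)-\mathcal G(\nu)}{t}$ and $\partial_C\mathcal G(\mu):=\{\Xi\in L^2_\mu:\ \langle\Xi,w\rangle_\mu\le D\mathcal G(\mu)(w)\ \ \forall w\in C_1(\mathbb R^d;\mathbb R^d)\}$. *)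

theory Defs
  imports "HOL-Probability.Probability"
begin

text \<open>
  An arbitrary Euclidean space \<open>'a\<close> plays the role of \<open>\<real>\<^sup>d\<close>. A functional on the Wasserstein
  space is a total function \<open>'a measure \<Rightarrow> real\<close>, of which only the values on \<open>P2\<close> are used.
\<close>

definition P2 :: "'a::euclidean_space measure set" where
  "P2 = {\<mu>. prob_space \<mu> \<and> sets \<mu> = sets borel \<and> integrable \<mu> (\<lambda>x. (norm x)\<^sup>2)}"

definition couplings ::
  "'a::euclidean_space measure \<Rightarrow> 'a measure \<Rightarrow> ('a \<times> 'a) measure set" where
  "couplings \<mu> \<nu> =
     {\<gamma>. prob_space \<gamma> \<and> sets \<gamma> = sets (borel \<Otimes>\<^sub>M borel) \<and>
          distr \<gamma> borel fst = \<mu> \<and> distr \<gamma> borel snd = \<nu>}"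

text \<open>
  On \<open>P2\<close> there is always a coupling (the product measure) and every cost is finite, so the real
  infimum and the Bochner integral below are never taken in a degenerate case.
\<close>

definition W2 :: "'a::euclidean_space measure \<Rightarrow> 'a measure \<Rightarrow> real" where
  "W2 \<mu> \<nu> = sqrt (INF \<gamma>\<in>couplings \<mu> \<nu>. LINT z|\<gamma>. (dist (fst z) (snd z))\<^sup>2)"

text \<open>The neighbourhood filter of \<open>\<mu>\<close> in \<open>(P2, W2)\<close>; the point \<open>\<mu>\<close> itself is not removed.\<close>

definition nhds_W2 :: "'a::euclidean_space measure \<Rightarrow> 'a measure filter" where
  "nhds_W2 \<mu> = (INF r\<in>{0<..}. principal {\<nu> \<in> P2. W2 \<nu> \<mu> < r})"

definition convex_along_plans :: "('a::euclidean_space measure \<Rightarrow> real) \<Rightarrow> bool" where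
  "convex_along_plans G \<longleftrightarrow>
     (\<forall>\<mu>\<in>P2. \<forall>\<nu>\<in>P2. \<forall>\<gamma>\<in>couplings \<mu> \<nu>. \<forall>t\<in>{0..1}.
        G (distr \<gamma> borel (\<lambda>z. (1 - t) *\<^sub>R fst z + t *\<^sub>R snd z)) \<le> (1 - t) * G \<mu> + t * G \<nu>)"

definition locally_Lipschitz_around ::
  "('a::euclidean_space measure \<Rightarrow> real) \<Rightarrow> 'a measure \<Rightarrow> bool" where
  "locally_Lipschitz_around G \<mu> \<longleftrightarrow>
     (\<exists>r>0. \<exists>L\<ge>0. \<forall>\<nu>\<in>P2. \<forall>\<rho>\<in>P2. W2 \<nu> \<mu> < r \<longrightarrow> W2 \<rho> \<mu> < r \<longrightarrow>
        \<bar>G \<nu> - G \<rho>\<bar> \<le> L * W2 \<nu> \<rho>)"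

definition argmin :: "('a::euclidean_space measure \<Rightarrow> real) \<Rightarrow> 'a measure set" where
  "argmin G = {\<mu>. is_arg_min G (\<lambda>\<nu>. \<nu> \<in> P2) \<mu>}"

definition C1 :: "('a::euclidean_space \<Rightarrow> 'a) set" where
  "C1 = {w. continuous_on UNIV w \<and> bdd_above (range (\<lambda>x. norm (w x) / (1 + norm x)))}"

text \<open>Elements of the space of square-integrable maps are given by representatives.\<close>

definition L2 :: "'a::euclidean_space measure \<Rightarrow> ('a \<Rightarrow> 'a) set" where
  "L2 \<mu> = {\<Xi>. \<Xi> \<in> borel_measurable \<mu> \<and> integrable \<mu> (\<lambda>x. (norm (\<Xi> x))\<^sup>2)}"

definition inner_L2 ::
  "'a::euclidean_space measure \<Rightarrow> ('a \<Rightarrow> 'a) \<Rightarrow> ('a \<Rightarrow> 'a) \<Rightarrow> real" where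
  "inner_L2 \<mu> \<Xi> w = (LINT x|\<mu>. \<Xi> x \<bullet> w x)"

text \<open>The joint upper limit is a priori only an extended real.\<close>

definition clarke_deriv ::
  "('a::euclidean_space measure \<Rightarrow> real) \<Rightarrow> 'a measure \<Rightarrow> ('a \<Rightarrow> 'a) \<Rightarrow> ereal" where
  "clarke_deriv G \<mu> w =
     Limsup (nhds_W2 \<mu> \<times>\<^sub>F at_right 0)
       (\<lambda>(\<nu>, t). ereal ((G (distr \<nu> borel (\<lambda>x. x + t *\<^sub>R w x)) - G \<nu>) / t))"

definition clarke_subdiff ::
  "('a::euclidean_space measure \<Rightarrow> real) \<Rightarrow> 'a measure \<Rightarrow> ('a \<Rightarrow> 'a) set" where
  "clarke_subdiff G \<mu> =
     {\<Xi> \<in> L2 \<mu>. \<forall>w\<in>C1. ereal (inner_L2 \<mu> \<Xi> w) \<le> clarke_deriv G \<mu> w}"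

end

theory Submission
  imports Defs
begin

text \<open>
  For a minimizer, the upper limit is bounded below by taking \<open>\<nu> = \<mu>\<close> in the difference quotients.

  Conversely, suppose \<open>G \<nu> < G \<mu>\<close> and let \<open>m\<close> be the mean of \<open>\<nu>\<close>. Replacing \<open>\<nu>\<close> by the law of
  the midpoint of two independent copies keeps the mean, halves the variance and, by convexity
  along the product plan, does not increase \<open>G\<close>. Interpolating \<open>\<mu>\<close> with these laws along product
  plans and letting the variance tend to \<open>0\<close> gives, for small \<open>s\<close>,
  \<open>G ((id + s w)\<^sub># \<mu>) \<le> (1 - s) G \<mu> + s G \<nu>\<close> with \<open>w x = m - x\<close>; only continuity of \<open>G\<close> near \<open>\<mu>\<close>
  enters. This single map \<open>w\<close> contradicts \<open>0 \<in> \<partial>\<^sub>C G \<mu>\<close>: difference quotients increase in \<open>t\<close>, and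
  the quotient at \<open>t = s\<close> is stable in \<open>\<nu>'\<close> near \<open>\<mu>\<close> since \<open>id + s w\<close> is a contraction, so the
  upper limit is negative.
\<close>

section \<open>Square-integrable random vectors over an arbitrary base space\<close>

definition square_integrable :: "'b measure \<Rightarrow> ('b \<Rightarrow> 'a::euclidean_space) \<Rightarrow> bool" where
  "square_integrable M Z \<longleftrightarrow> Z \<in> borel_measurable M \<and> integrable M (\<lambda>x. (norm (Z x))\<^sup>2)"

lemma square_integrable_measurable [measurable_dest]:
  "square_integrable M Z \<Longrightarrow> Z \<in> borel_measurable M"
  by (simp add: square_integrable_def)

lemma norm_add_squared_le:
  fixes a b :: "'a::euclidean_space"
  shows "(norm (a + b))\<^sup>2 \<le> 2 * (norm a)\<^sup>2 + 2 * (norm b)\<^sup>2"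
proof -
  have "(norm (a + b))\<^sup>2 + (norm (a - b))\<^sup>2 = 2 * (norm a)\<^sup>2 + 2 * (norm b)\<^sup>2"
    by (simp add: power2_norm_eq_inner algebra_simps)
  then show ?thesis
    using zero_le_power2[of "norm (a - b)"] by linarith
qed

lemma square_integrable_scaleR:
  assumes "square_integrable M Z"
  shows "square_integrable M (\<lambda>x. c *\<^sub>R Z x)"
  using assms by (auto simp: square_integrable_def power_mult_distrib)

lemma square_integrable_add:
  assumes "square_integrable M Y" "square_integrable M Z"
  shows "square_integrable M (\<lambda>x. Y x + Z x)"
proof -
  have "integrable M (\<lambda>x. 2 * (norm (Y x))\<^sup>2 + 2 * (norm (Z x))\<^sup>2)"
    using assms by (auto simp: square_integrable_def)
  then have "integrable M (\<lambda>x. (norm (Y x + Z x))\<^sup>2)"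
  proof (rule Bochner_Integration.integrable_bound)
    show "(\<lambda>x. (norm (Y x + Z x))\<^sup>2) \<in> borel_measurable M"
      using assms by (auto simp: square_integrable_def)
    show "AE x in M. norm ((norm (Y x + Z x))\<^sup>2) \<le> norm (2 * (norm (Y x))\<^sup>2 + 2 * (norm (Z x))\<^sup>2)"
      using norm_add_squared_le by (intro AE_I2) simp
  qed
  then show ?thesis
    using assms by (auto simp: square_integrable_def)
qed

lemma square_integrable_diff:
  assumes "square_integrable M Y" "square_integrable M Z"
  shows "square_integrable M (\<lambda>x. Y x - Z x)"
  using square_integrable_add[OF assms(1) square_integrable_scaleR[OF assms(2), of "-1"]] by simp

lemma square_integrable_const:
  assumes "prob_space M"
  shows "square_integrable M (\<lambda>x. c)"
  using assms by (auto simp: square_integrable_def finite_measure.integrable_const prob_space_def)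

lemma square_integrable_integrable:
  fixes Z :: "'b \<Rightarrow> 'a::euclidean_space"
  assumes "prob_space M" "square_integrable M Z"
  shows "integrable M Z"
proof -
  interpret prob_space M by fact
  have "integrable M (\<lambda>x. 1 + (norm (Z x))\<^sup>2)"
    using assms by (auto simp: square_integrable_def)
  moreover have "norm (Z x) \<le> 1 + (norm (Z x))\<^sup>2" for x
    \<comment> \<open>Expanding the square of \<open>norm (Z x) - 1/2\<close> gives
      \<open>norm (Z x) \<le> (norm (Z x))\<^sup>2 + 1/4\<close>.\<close>
    using sum_power2_ge_zero[of "norm (Z x) - 1/2" 0]
    by (simp add: power2_eq_square algebra_simps)
  ultimately show ?thesis
    using assms(2) by (rule_tac Bochner_Integration.integrable_bound[where f = "\<lambda>x. 1 + (norm (Z x))\<^sup>2"])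
      (auto simp: square_integrable_def)
qed

lemma square_integrable_distr:
  assumes "f \<in> M \<rightarrow>\<^sub>M N" "square_integrable (distr M N f) Z"
  shows "square_integrable M (\<lambda>x. Z (f x))"
  using assms by (auto simp: square_integrable_def integrable_distr_eq)

lemma integral_norm_add_squared_le:
  assumes "square_integrable M Y" "square_integrable M Z"
  shows "(LINT x|M. (norm (Y x + Z x))\<^sup>2)
    \<le> 2 * (LINT x|M. (norm (Y x))\<^sup>2) + 2 * (LINT x|M. (norm (Z x))\<^sup>2)"
proof -
  have "(LINT x|M. (norm (Y x + Z x))\<^sup>2)
      \<le> (LINT x|M. 2 * (norm (Y x))\<^sup>2 + 2 * (norm (Z x))\<^sup>2)"
    using assms square_integrable_add[OF assms]
    by (intro integral_mono norm_add_squared_le) (auto simp: square_integrable_def)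
  also have "\<dots> = 2 * (LINT x|M. (norm (Y x))\<^sup>2) + 2 * (LINT x|M. (norm (Z x))\<^sup>2)"
    using assms by (auto simp: square_integrable_def)
  finally show ?thesis .
qed

section \<open>The space \<open>P2\<close>, couplings as joint laws, and \<open>W2\<close>\<close>

lemma P2_iff:
  "\<mu> \<in> P2 \<longleftrightarrow> prob_space \<mu> \<and> sets \<mu> = sets borel \<and> square_integrable \<mu> (\<lambda>x. x)"
proof -
  have "(\<lambda>x. x) \<in> borel_measurable \<mu>" if "sets \<mu> = sets borel"
    using measurable_ident_sets[OF that] by simp
  then show ?thesis
    by (auto simp: P2_def square_integrable_def)
qed

lemma distr_in_P2:
  assumes "prob_space M" "square_integrable M Z"
  shows "distr M borel Z \<in> P2"
  using assms
  by (auto simp: P2_def square_integrable_def integrable_distr_eq prob_space.prob_space_distr)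

lemma distr_pair_in_couplings:
  assumes "prob_space M" and [measurable]: "Y \<in> borel_measurable M" "Z \<in> borel_measurable M"
  shows "distr M (borel \<Otimes>\<^sub>M borel) (\<lambda>x. (Y x, Z x)) \<in> couplings (distr M borel Y) (distr M borel Z)"
  using assms(1)
  by (auto simp: couplings_def distr_distr comp_def intro!: prob_space.prob_space_distr)

text \<open>The joint law of \<open>Y\<close> and \<open>Z\<close> is a coupling, so its cost bounds
  the infimum from above. All later upper bounds on \<open>W2\<close> come from exhibiting two
  random vectors on one space.\<close>

lemma W2_distr_less:
  assumes "prob_space M" and [measurable]: "Y \<in> borel_measurable M" "Z \<in> borel_measurable M"
    and "(LINT x|M. (norm (Y x - Z x))\<^sup>2) < r\<^sup>2" "0 < r"
  shows "W2 (distr M borel Y) (distr M borel Z) < r"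
proof -
  let ?C = "couplings (distr M borel Y) (distr M borel Z)"
  let ?\<gamma> = "distr M (borel \<Otimes>\<^sub>M borel) (\<lambda>x. (Y x, Z x))"
  have "(INF \<gamma>\<in>?C. LINT z|\<gamma>. (dist (fst z) (snd z))\<^sup>2) \<le> (LINT z|?\<gamma>. (dist (fst z) (snd z))\<^sup>2)"
    by (intro cINF_lower bdd_belowI2[of _ 0] distr_pair_in_couplings assms) auto
  also have "\<dots> = (LINT x|M. (norm (Y x - Z x))\<^sup>2)"
    by (subst integral_distr) (auto simp: dist_norm)
  also note assms(4)
  finally show ?thesis
    unfolding W2_def using \<open>0 < r\<close> by (intro real_less_lsqrt) auto
qed

lemma distr_pair_snd:
  assumes "prob_space M" "prob_space N"
  shows "distr (M \<Otimes>\<^sub>M N) N snd = N"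
proof (intro measure_eqI)
  interpret M: prob_space M by fact
  interpret N: prob_space N by fact
  fix A assume A: "A \<in> sets (distr (M \<Otimes>\<^sub>M N) N snd)"
  from A have "emeasure (distr (M \<Otimes>\<^sub>M N) N snd) A = emeasure (M \<Otimes>\<^sub>M N) (space M \<times> A)"
    by (auto simp add: emeasure_distr space_pair_measure dest: sets.sets_into_space
        intro!: arg_cong2[where f=emeasure])
  with A show "emeasure (distr (M \<Otimes>\<^sub>M N) N snd) A = emeasure N A"
    by (simp add: N.emeasure_pair_measure_Times M.emeasure_space_1)
qed simp

lemma product_coupling:
  assumes "\<mu> \<in> P2" "\<nu> \<in> P2"
  shows "\<mu> \<Otimes>\<^sub>M \<nu> \<in> couplings \<mu> \<nu>"
proof -
  have *: "prob_space \<mu>" "prob_space \<nu>" "sets \<mu> = sets borel" "sets \<nu> = sets borel"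
    using assms by (auto simp: P2_iff)
  interpret pair_prob_space \<mu> \<nu>
    using * by (simp add: pair_prob_space_def pair_sigma_finite_def prob_space_imp_sigma_finite)
  have "distr (\<mu> \<Otimes>\<^sub>M \<nu>) borel fst = distr (\<mu> \<Otimes>\<^sub>M \<nu>) \<mu> fst"
    "distr (\<mu> \<Otimes>\<^sub>M \<nu>) borel snd = distr (\<mu> \<Otimes>\<^sub>M \<nu>) \<nu> snd"
    by (rule distr_cong; simp add: *)+
  moreover have "sets (\<mu> \<Otimes>\<^sub>M \<nu>) = sets (borel \<Otimes>\<^sub>M borel)"
    by (rule sets_pair_measure_cong[OF *(3,4)])
  ultimately show ?thesis
    by (simp add: couplings_def prob_space.distr_pair_fst[OF *(2)] distr_pair_snd[OF *(1,2)]
        prob_space_axioms)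
qed

text \<open>Converse to the bound by random vectors: a strict bound on the infimum is already
  attained by some plan, and this near-optimal plan can stand in for an optimal one.\<close>

lemma W2_less_coupling:
  assumes "\<mu> \<in> P2" "\<nu> \<in> P2" "W2 \<mu> \<nu> < r"
  obtains \<gamma> where "\<gamma> \<in> couplings \<mu> \<nu>" "(LINT z|\<gamma>. (norm (fst z - snd z))\<^sup>2) < r\<^sup>2"
proof -
  let ?I = "INF \<gamma>\<in>couplings \<mu> \<nu>. LINT z|\<gamma>. (dist (fst z) (snd z))\<^sup>2"
  \<comment> \<open>Nonemptiness makes the real infimum meaningful and nonnegative, so that the
    square root can be squared away.\<close>
  have ne: "couplings \<mu> \<nu> \<noteq> {}"
    using product_coupling[OF assms(1,2)] by auto
  then have "0 \<le> ?I"
    by (intro cINF_greatest) auto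
  moreover have "sqrt ?I < r"
    using assms(3) by (simp add: W2_def)
  ultimately have "?I < r\<^sup>2"
    using power_strict_mono[of "sqrt ?I" r 2] by simp
  then show ?thesis
    using ne that by (subst (asm) cINF_less_iff) (auto simp: dist_norm intro!: bdd_belowI2[of _ 0])
qed

lemma coupling_distr:
  assumes "\<gamma> \<in> couplings \<mu> \<nu>"
  shows "prob_space \<gamma>" "fst \<in> borel_measurable \<gamma>" "snd \<in> borel_measurable \<gamma>"
    "distr \<gamma> borel fst = \<mu>" "distr \<gamma> borel snd = \<nu>"
proof -
  have s: "sets \<gamma> = sets (borel \<Otimes>\<^sub>M borel)"
    using assms by (auto simp: couplings_def)
  show "prob_space \<gamma>" "distr \<gamma> borel fst = \<mu>" "distr \<gamma> borel snd = \<nu>"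
    using assms by (auto simp: couplings_def)
  show "fst \<in> borel_measurable \<gamma>" "snd \<in> borel_measurable \<gamma>"
    by (simp_all add: measurable_cong_sets[OF s refl])
qed

lemma coupling_square_integrable:
  assumes "\<mu> \<in> P2" "\<nu> \<in> P2" "\<gamma> \<in> couplings \<mu> \<nu>"
  shows "square_integrable \<gamma> fst" "square_integrable \<gamma> snd"
proof -
  note c = coupling_distr[OF assms(3)]
  have "square_integrable (distr \<gamma> borel fst) (\<lambda>x. x)" "square_integrable (distr \<gamma> borel snd) (\<lambda>x. x)"
    unfolding c(4,5) using assms by (simp_all add: P2_iff)
  then show "square_integrable \<gamma> fst" "square_integrable \<gamma> snd"
    using square_integrable_distr[OF c(2)] square_integrable_distr[OF c(3)] by blast+
qed

section \<open>Convexity along plans and reduction of the variance\<close>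

text \<open>Convexity for the plan that is the joint law of \<open>Y\<close> and \<open>Z\<close>; a
  plan can then be chosen by naming two maps on a convenient space.\<close>

lemma convex_along_plansD:
  assumes "convex_along_plans G" "prob_space M" "square_integrable M Y" "square_integrable M Z"
    "0 \<le> t" "t \<le> 1"
  shows "G (distr M borel (\<lambda>x. (1 - t) *\<^sub>R Y x + t *\<^sub>R Z x))
    \<le> (1 - t) * G (distr M borel Y) + t * G (distr M borel Z)"
proof -
  let ?\<gamma> = "distr M (borel \<Otimes>\<^sub>M borel) (\<lambda>x. (Y x, Z x))"
  note [measurable] = assms(3,4)[THEN square_integrable_measurable]
  have "G (distr ?\<gamma> borel (\<lambda>z. (1 - t) *\<^sub>R fst z + t *\<^sub>R snd z))
      \<le> (1 - t) * G (distr M borel Y) + t * G (distr M borel Z)"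
    using assms(1)[unfolded convex_along_plans_def, rule_format, of "distr M borel Y" "distr M borel Z" ?\<gamma> t]
      distr_pair_in_couplings[OF assms(2), of Y Z] distr_in_P2[OF assms(2,3)] distr_in_P2[OF assms(2,4)]
      assms(3-6)
    by (auto dest: square_integrable_measurable)
  then show ?thesis
    by (simp add: distr_distr comp_def)
qed

text \<open>For independent centred copies the cross term has mean zero, so the midpoint has a
  quarter of the summed variances. Both marginals of the product plan are \<nu>, hence convexity at
  \<open>1/2\<close> bounds the value by \<open>G \<nu>\<close> itself.\<close>

lemma halve_variance:
  fixes \<nu> :: "'a::euclidean_space measure"
  assumes G: "convex_along_plans G" and \<nu>: "\<nu> \<in> P2"
  defines "m \<equiv> (LINT z|\<nu>. z)"
  defines "\<rho> \<equiv> distr (\<nu> \<Otimes>\<^sub>M \<nu>) borel (\<lambda>z. (1 / 2) *\<^sub>R fst z + (1 / 2) *\<^sub>R snd z)"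
  shows "\<rho> \<in> P2" "(LINT z|\<rho>. z) = m" "G \<rho> \<le> G \<nu>"
    "(LINT z|\<rho>. (norm (z - m))\<^sup>2) = (LINT z|\<nu>. (norm (z - m))\<^sup>2) / 2"
proof -
  let ?N = "\<nu> \<Otimes>\<^sub>M \<nu>"
  have p: "prob_space \<nu>" and sq: "square_integrable \<nu> (\<lambda>x. x)" and s: "sets \<nu> = sets borel"
    using \<nu> by (auto simp: P2_iff)
  interpret prob_space \<nu> by fact
  interpret pair_prob_space \<nu> \<nu> ..
  have c: "?N \<in> couplings \<nu> \<nu>"
    using product_coupling \<nu> by auto
  note c' = coupling_distr[OF c] coupling_square_integrable[OF \<nu> \<nu> c]
  note [measurable] = c'(2,3)
  have mid: "square_integrable ?N (\<lambda>z. (1 / 2) *\<^sub>R fst z + (1 / 2) *\<^sub>R snd z)"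
    by (intro square_integrable_add square_integrable_scaleR c')
  note [measurable] = square_integrable_measurable[OF mid]
  show "\<rho> \<in> P2"
    unfolding \<rho>_def by (intro distr_in_P2 mid c')
  show "G \<rho> \<le> G \<nu>"
    using convex_along_plansD[OF G c'(1,6,7), of "1/2"] by (simp add: \<rho>_def c'(4,5))
  have int: "integrable ?N fst" "integrable ?N snd"
    by (auto intro!: square_integrable_integrable c')
  have fst: "(LINT z|?N. f (fst z)) = (LINT z|\<nu>. f z)"
    and snd: "(LINT z|?N. f (snd z)) = (LINT z|\<nu>. f z)"
    if [measurable]: "f \<in> borel_measurable borel" for f :: "'a \<Rightarrow> 'c::{banach, second_countable_topology}"
    using integral_distr[of fst ?N borel f] integral_distr[of snd ?N borel f] c' by auto
  show "(LINT z|\<rho>. z) = m"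
    using int fst[of "\<lambda>x. x"] snd[of "\<lambda>x. x"]
    by (simp add: \<rho>_def integral_distr m_def scaleR_add_left[symmetric])
  have sqm: "square_integrable ?N (\<lambda>z. fst z - m)" "square_integrable ?N (\<lambda>z. snd z - m)"
    by (intro square_integrable_diff square_integrable_const c')+
  have sqi: "integrable ?N (\<lambda>z. (norm (fst z - m))\<^sup>2)" "integrable ?N (\<lambda>z. (norm (snd z - m))\<^sup>2)"
    "integrable ?N (\<lambda>z. (norm ((fst z - m) + (snd z - m)))\<^sup>2)"
    using sqm square_integrable_add[OF sqm] by (auto simp: square_integrable_def)
  \<comment> \<open>Polarization writes the cross term through squared norms, which yields its
    integrability from that of the squares.\<close>
  have polar: "(fst z - m) \<bullet> (snd z - m) = ((norm ((fst z - m) + (snd z - m)))\<^sup>2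
      - (norm (fst z - m))\<^sup>2 - (norm (snd z - m))\<^sup>2) / 2" for z :: "'a \<times> 'a"
    unfolding power2_norm_eq_inner by (simp add: inner_commute algebra_simps)
  have crossi: "integrable ?N (\<lambda>z. (fst z - m) \<bullet> (snd z - m))"
    unfolding polar using sqi by simp
  \<comment> \<open>By Fubini the inner integral pairs \<open>x - m\<close> with the mean of
    \<open>y - m\<close>, which vanishes.\<close>
  have "(LINT z|?N. (fst z - m) \<bullet> (snd z - m)) = (LINT x|\<nu>. LINT y|\<nu>. (x - m) \<bullet> (y - m))"
    using integral_fst'[OF crossi] by simp
  also have "\<dots> = 0"
  proof -
    have i: "integrable \<nu> (\<lambda>y. y)"
      using square_integrable_integrable[OF p sq] .
    then have "(LINT y|\<nu>. (x - m) \<bullet> (y - m)) = (x - m) \<bullet> (LINT y|\<nu>. y - m)" for x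
      by (intro integral_inner_right) auto
    moreover have "(LINT y|\<nu>. y - m) = 0"
      using i by (simp add: m_def prob_space.prob_space[OF p])
    ultimately show ?thesis by simp
  qed
  finally have cross: "(LINT z|?N. (fst z - m) \<bullet> (snd z - m)) = 0" .
  have "(norm ((1 / 2) *\<^sub>R fst z + (1 / 2) *\<^sub>R snd z - m))\<^sup>2
      = (norm (fst z - m))\<^sup>2 / 4 + (norm (snd z - m))\<^sup>2 / 4 + ((fst z - m) \<bullet> (snd z - m)) / 2"
    for z :: "'a \<times> 'a"
  proof -
    have "(1 / 2) *\<^sub>R fst z + (1 / 2) *\<^sub>R snd z - m = (1 / 2) *\<^sub>R ((fst z - m) + (snd z - m))"
      by (simp add: algebra_simps scaleR_add_left[symmetric])
    then have "(norm ((1 / 2) *\<^sub>R fst z + (1 / 2) *\<^sub>R snd z - m))\<^sup>2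
        = (norm ((fst z - m) + (snd z - m)))\<^sup>2 / 4"
      by (simp only: norm_scaleR power_mult_distrib) (simp add: power_divide)
    then show ?thesis
      unfolding polar by (simp add: field_simps)
  qed
  then have "(LINT z|\<rho>. (norm (z - m))\<^sup>2) = (LINT z|?N. (norm (fst z - m))\<^sup>2 / 4
      + (norm (snd z - m))\<^sup>2 / 4 + ((fst z - m) \<bullet> (snd z - m)) / 2)"
    by (simp add: \<rho>_def integral_distr)
  also have "\<dots> = (LINT z|\<nu>. (norm (z - m))\<^sup>2) / 2"
    using sqi crossi cross fst[of "\<lambda>x. (norm (x - m))\<^sup>2"] snd[of "\<lambda>x. (norm (x - m))\<^sup>2"] by simp
  finally show "(LINT z|\<rho>. (norm (z - m))\<^sup>2) = (LINT z|\<nu>. (norm (z - m))\<^sup>2) / 2" .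
qed

lemma reduce_variance:
  fixes \<nu> :: "'a::euclidean_space measure"
  assumes "convex_along_plans G" "\<nu> \<in> P2"
  shows "\<exists>\<rho>\<in>P2. (LINT z|\<rho>. z) = (LINT z|\<nu>. z) \<and> G \<rho> \<le> G \<nu> \<and>
    (LINT z|\<rho>. (norm (z - (LINT z|\<nu>. z)))\<^sup>2) = (LINT z|\<nu>. (norm (z - (LINT z|\<nu>. z)))\<^sup>2) / 2 ^ n"
proof (induction n)
  case 0
  then show ?case using assms by auto
next
  case (Suc n)
  then obtain \<rho> where \<rho>: "\<rho> \<in> P2" "(LINT z|\<rho>. z) = (LINT z|\<nu>. z)" "G \<rho> \<le> G \<nu>"
    "(LINT z|\<rho>. (norm (z - (LINT z|\<nu>. z)))\<^sup>2) = (LINT z|\<nu>. (norm (z - (LINT z|\<nu>. z)))\<^sup>2) / 2 ^ n"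
    by blast
  show ?case
    \<comment> \<open>Halving concerns the variance about the mean of \<rho>; since that mean is
      still the one of \<nu>, the centre is the same at every stage.\<close>
    using halve_variance[OF assms(1) \<rho>(1)] \<rho>
    by (intro bexI[OF _ halve_variance(1)[OF assms(1) \<rho>(1)]]) auto
qed

section \<open>Moving \<mu> towards the mean of a competitor\<close>

text \<open>The target \<open>m\<close> is approximated by measures \<rho> of small variance about
  it. \<open>Lip\<close> speaks only of measures near \<mu>, so \<rho> is not compared with the
  Dirac mass at \<open>m\<close>; instead the interpolants of \<mu> with each are compared, and
  \<open>small\<close> keeps both within distance \<open>r\<close> of \<mu>.\<close>

lemma shift_to_mean:
  fixes \<mu> \<nu> :: "'a::euclidean_space measure"
  assumes G: "convex_along_plans G" and \<mu>: "\<mu> \<in> P2" and \<nu>: "\<nu> \<in> P2"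
    and "0 < r" "0 \<le> L"
    and Lip: "\<And>\<nu> \<rho>. \<nu> \<in> P2 \<Longrightarrow> \<rho> \<in> P2 \<Longrightarrow> W2 \<nu> \<mu> < r \<Longrightarrow> W2 \<rho> \<mu> < r \<Longrightarrow> \<bar>G \<nu> - G \<rho>\<bar> \<le> L * W2 \<nu> \<rho>"
    and s: "0 \<le> s" "s \<le> 1"
  defines "m \<equiv> (LINT z|\<nu>. z)"
  assumes small: "s\<^sup>2 * (2 * (LINT z|\<nu>. (norm (z - m))\<^sup>2) + 2 * (LINT x|\<mu>. (norm (m - x))\<^sup>2)) < r\<^sup>2"
  shows "G (distr \<mu> borel (\<lambda>x. (1 - s) *\<^sub>R x + s *\<^sub>R m)) \<le> (1 - s) * G \<mu> + s * G \<nu>"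
proof (rule field_le_epsilon)
  fix e :: real assume "0 < e"
  define V where "V = (LINT z|\<nu>. (norm (z - m))\<^sup>2)"
  define D where "D = (LINT x|\<mu>. (norm (m - x))\<^sup>2)"
  have V: "0 \<le> V" "0 \<le> D"
    by (simp_all add: V_def D_def)
  \<comment> \<open>Chosen so that \<open>L * d \<le> e\<close>; the summand 1 covers the case
    \<open>L = 0\<close>.\<close>
  define d where "d = e / (L + 1)"
  have "0 < d" using \<open>0 < e\<close> \<open>0 \<le> L\<close> by (simp add: d_def)
  have "(\<lambda>n. V * (1 / 2) ^ n) \<longlonglongrightarrow> V * 0"
    by (intro tendsto_mult_left LIMSEQ_power_zero) simp
  moreover have "V * 0 < d\<^sup>2" using \<open>0 < d\<close> by simp
  ultimately have "\<forall>\<^sub>F n in sequentially. V * (1 / 2) ^ n < d\<^sup>2"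
    by (rule order_tendstoD)
  then obtain n where n: "V * (1 / 2) ^ n < d\<^sup>2"
    by (auto simp: eventually_sequentially)
  obtain \<rho> where \<rho>: "\<rho> \<in> P2" "G \<rho> \<le> G \<nu>" "(LINT z|\<rho>. (norm (z - m))\<^sup>2) = V / 2 ^ n"
    using reduce_variance[OF G \<nu>, of n] unfolding m_def[symmetric] V_def[symmetric] by blast
  define W where "W = V / 2 ^ n"
  have W: "0 \<le> W" "W \<le> V" "W < d\<^sup>2"
    using n V by (auto simp: W_def power_divide field_simps mult_le_cancel_left1)
  let ?N = "\<mu> \<Otimes>\<^sub>M \<rho>"
  have c: "?N \<in> couplings \<mu> \<rho>"
    using product_coupling \<mu> \<rho> by auto
  note c' = coupling_distr[OF c] coupling_square_integrable[OF \<mu> \<rho>(1) c]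
  note [measurable] = c'(2,3)
  \<comment> \<open>\<open>?Y\<close> interpolates with an independent sample of \<rho>,
    \<open>?U\<close> with the constant \<open>m\<close>; they differ by \<open>s\<close> times the
    deviation of that sample from \<open>m\<close>.\<close>
  let ?Y = "\<lambda>z. (1 - s) *\<^sub>R fst z + s *\<^sub>R snd z" and ?U = "\<lambda>z. (1 - s) *\<^sub>R fst z + s *\<^sub>R m"
  have sq: "square_integrable ?N ?Y" "square_integrable ?N ?U"
    "square_integrable ?N (\<lambda>z. m - fst z)" "square_integrable ?N (\<lambda>z. snd z - m)"
    by (intro square_integrable_add square_integrable_scaleR square_integrable_diff
        square_integrable_const c')+
  have fst: "(LINT z|?N. f (fst z)) = (LINT z|\<mu>. f z)"
    and snd: "(LINT z|?N. f (snd z)) = (LINT z|\<rho>. f z)"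
    if [measurable]: "f \<in> borel_measurable borel" for f :: "'a \<Rightarrow> real"
    using integral_distr[of fst ?N borel f] integral_distr[of snd ?N borel f] c' by auto
  have DN: "(LINT z|?N. (norm (m - fst z))\<^sup>2) = D"
    using fst[of "\<lambda>x. (norm (m - x))\<^sup>2"] by (simp add: D_def)
  have VN: "(LINT z|?N. (norm (snd z - m))\<^sup>2) = W"
    using snd[of "\<lambda>x. (norm (x - m))\<^sup>2"] \<rho>(3) by (simp add: W_def)
  have m1: "?U z - fst z = s *\<^sub>R (m - fst z)" "?Y z - fst z = s *\<^sub>R ((snd z - m) + (m - fst z))"
    "?U z - ?Y z = s *\<^sub>R (- (snd z - m))" for z
    by (auto simp: algebra_simps)
  have sr: "s\<^sup>2 * (2 * V + 2 * D) < r\<^sup>2"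
    using small by (simp add: V_def D_def)
  have "(LINT z|?N. (norm (?U z - fst z))\<^sup>2) = s\<^sup>2 * D"
    unfolding m1 by (simp add: power_mult_distrib DN)
  also have "\<dots> \<le> s\<^sup>2 * (2 * V + 2 * D)"
    using V by (intro mult_left_mono) auto
  finally have WU: "W2 (distr ?N borel ?U) \<mu> < r"
    using W2_distr_less[OF c'(1) square_integrable_measurable[OF sq(2)] c'(2)] \<open>0 < r\<close> sr
    unfolding c'(4) by auto
  have "(LINT z|?N. (norm (?Y z - fst z))\<^sup>2)
      = s\<^sup>2 * (LINT z|?N. (norm ((snd z - m) + (m - fst z)))\<^sup>2)"
    unfolding m1 by (simp add: power_mult_distrib)
  also have "\<dots> \<le> s\<^sup>2 * (2 * W + 2 * D)"
    using integral_norm_add_squared_le[OF sq(4,3)] unfolding VN DN by (intro mult_left_mono) auto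
  also have "\<dots> \<le> s\<^sup>2 * (2 * V + 2 * D)"
    using W by (intro mult_left_mono) auto
  finally have WY: "W2 (distr ?N borel ?Y) \<mu> < r"
    using W2_distr_less[OF c'(1) square_integrable_measurable[OF sq(1)] c'(2)] \<open>0 < r\<close> sr
    unfolding c'(4) by auto
  have "(LINT z|?N. (norm (?U z - ?Y z))\<^sup>2) = s\<^sup>2 * W"
    unfolding m1 norm_scaleR norm_minus_cancel by (simp add: power_mult_distrib VN)
  also have "\<dots> \<le> 1 * W"
    using W s by (intro mult_right_mono) (auto simp: power_le_one)
  finally have UY: "W2 (distr ?N borel ?U) (distr ?N borel ?Y) < d"
    using W2_distr_less[OF c'(1) sq(2,1)[THEN square_integrable_measurable]] \<open>0 < d\<close> W by auto
  have "\<bar>G (distr ?N borel ?U) - G (distr ?N borel ?Y)\<bar>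
      \<le> L * W2 (distr ?N borel ?U) (distr ?N borel ?Y)"
    by (intro Lip distr_in_P2 c' sq WU WY)
  also have "\<dots> \<le> L * d"
    using UY \<open>0 \<le> L\<close> by (intro mult_left_mono) auto
  also have "\<dots> \<le> e"
    using \<open>0 < e\<close> \<open>0 \<le> L\<close> by (simp add: d_def field_simps)
  finally have "G (distr ?N borel ?U) \<le> G (distr ?N borel ?Y) + e"
    by linarith
  also have "G (distr ?N borel ?Y) \<le> (1 - s) * G \<mu> + s * G \<rho>"
    using convex_along_plansD[OF G c'(1,6,7) s] unfolding c'(4,5) .
  also have "s * G \<rho> \<le> s * G \<nu>"
    using \<rho> s by (intro mult_left_mono) auto
  \<comment> \<open>\<open>?U\<close> depends on the first coordinate alone, so its law is a
    push-forward of \<mu>.\<close>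
  also have "distr ?N borel ?U = distr (distr ?N borel fst) borel (\<lambda>x. (1 - s) *\<^sub>R x + s *\<^sub>R m)"
    by (subst distr_distr) (auto simp: comp_def)
  finally show "G (distr \<mu> borel (\<lambda>x. (1 - s) *\<^sub>R x + s *\<^sub>R m)) \<le> (1 - s) * G \<mu> + s * G \<nu> + e"
    unfolding c'(4) by simp
qed

section \<open>Test maps and the sign of the Clarke derivative at a minimizer\<close>

text \<open>Linear growth bounds the squared norm by a multiple of
  \<open>2 + 2 * (norm x)\<^sup>2\<close>. Hence perturbing by a test map does not leave
  \<open>P2\<close>.\<close>

lemma C1_square_integrable:
  assumes "w \<in> C1" "\<mu> \<in> P2"
  shows "square_integrable \<mu> w"
proof -
  have \<mu>: "prob_space \<mu>" "square_integrable \<mu> (\<lambda>x. x)" "sets \<mu> = sets borel"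
    using assms by (auto simp: P2_iff)
  obtain C where C: "norm (w x) / (1 + norm x) \<le> C" for x
    using assms by (auto simp: C1_def bdd_above_def)
  have "norm (w x) \<le> C * (1 + norm x)" for x
    using C[of x] by (simp add: divide_le_eq add_pos_nonneg)
  then have "(norm (w x))\<^sup>2 \<le> C\<^sup>2 * (1 + norm x)\<^sup>2" for x
    using power_mono[of "norm (w x)" "C * (1 + norm x)" 2] by (simp add: power_mult_distrib)
  moreover have "(1 + norm x)\<^sup>2 \<le> 2 + 2 * (norm x)\<^sup>2" for x :: 'a
    using zero_le_power2[of "1 - norm x"] by (simp add: power2_eq_square algebra_simps)
  ultimately have bound: "(norm (w x))\<^sup>2 \<le> C\<^sup>2 * (2 + 2 * (norm x)\<^sup>2)" for x
    by (meson mult_left_mono order_trans zero_le_power2)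
  have "w \<in> borel_measurable borel"
    using assms by (auto simp: C1_def intro: borel_measurable_continuous_onI)
  then have w[measurable]: "w \<in> borel_measurable \<mu>"
    using \<mu>(3) by (simp cong: measurable_cong_sets)
  interpret prob_space \<mu> by fact
  have "integrable \<mu> (\<lambda>x. C\<^sup>2 * (2 + 2 * (norm x)\<^sup>2))"
    using \<mu>(2) by (auto simp: square_integrable_def)
  then have "integrable \<mu> (\<lambda>x. (norm (w x))\<^sup>2)"
    by (rule Bochner_Integration.integrable_bound) (auto intro: order_trans[OF bound])
  with w show ?thesis by (simp add: square_integrable_def)
qed

lemma W2_self_less:
  assumes "\<mu> \<in> P2" "0 < r"
  shows "W2 \<mu> \<mu> < r"
proof -
  have p: "prob_space \<mu>" "(\<lambda>x. x) \<in> borel_measurable \<mu>" "sets \<mu> = sets borel"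
    using assms by (auto simp: P2_iff square_integrable_def)
  have id: "distr \<mu> borel (\<lambda>x. x) = \<mu>"
    using p distr_id2[of borel \<mu>] by (simp add: id_def)
  show ?thesis
    using W2_distr_less[OF p(1,2,2), of r] assms(2) unfolding id by simp
qed

text \<open>The filter keeps its centre, which makes \<mu> itself an admissible base point in the
  upper limit.\<close>

lemma eventually_nhds_W2_center:
  assumes "\<mu> \<in> P2" "eventually P (nhds_W2 \<mu>)"
  shows "P \<mu>"
proof -
  have "principal {\<mu>} \<le> nhds_W2 \<mu>"
    using assms(1) W2_self_less unfolding nhds_W2_def by (intro INF_greatest) auto
  then show ?thesis
    using assms(2) by (auto simp: le_filter_def eventually_principal)
qed

text \<open>Every set of the product filter contains a pair \<open>(\<mu>, t)\<close> with
  \<open>t > 0\<close>. The quotient there is nonnegative by minimality, so every supremum in the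
  upper limit is.\<close>

lemma clarke_deriv_nonneg_of_argmin:
  assumes \<mu>: "\<mu> \<in> P2" and min: "\<mu> \<in> argmin G" and w: "w \<in> C1"
  shows "0 \<le> clarke_deriv G \<mu> w"
  unfolding clarke_deriv_def
proof (rule Limsup_greatest)
  fix P assume "eventually P (nhds_W2 \<mu> \<times>\<^sub>F at_right (0::real))"
  then obtain Q R where QR: "eventually Q (nhds_W2 \<mu>)" "eventually R (at_right 0)"
    "\<And>\<nu> t. Q \<nu> \<Longrightarrow> R t \<Longrightarrow> P (\<nu>, t)"
    by (auto simp: eventually_prod_filter)
  from QR(2) obtain b where b: "0 < b" "\<And>t. 0 < t \<Longrightarrow> t < b \<Longrightarrow> R t"
    by (auto simp: eventually_at_right_field)
  define t where "t = b / 2"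
  have t: "0 < t" "R t"
    using b by (auto simp: t_def)
  have "distr \<mu> borel (\<lambda>x. x + t *\<^sub>R w x) \<in> P2"
    using \<mu> C1_square_integrable[OF w \<mu>]
    by (intro distr_in_P2 square_integrable_add square_integrable_scaleR) (auto simp: P2_iff)
  then have "G \<mu> \<le> G (distr \<mu> borel (\<lambda>x. x + t *\<^sub>R w x))"
    using min by (auto simp: argmin_def is_arg_min_def not_less)
  then have "0 \<le> ereal ((G (distr \<mu> borel (\<lambda>x. x + t *\<^sub>R w x)) - G \<mu>) / t)"
    using t by simp
  moreover have "P (\<mu>, t)"
    using QR(3) eventually_nhds_W2_center[OF \<mu> QR(1)] t by auto
  ultimately show "0 \<le> (SUP x\<in>Collect P.
      case x of (\<nu>, t) \<Rightarrow> ereal ((G (distr \<nu> borel (\<lambda>x. x + t *\<^sub>R w x)) - G \<nu>) / t))"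
    by (intro SUP_upper2[of "(\<mu>, t)"]) auto
qed

section \<open>Negativity of the Clarke derivative at a non-minimizer\<close>

text \<open>\<open>id + t w\<close> is the interpolation with weight \<open>t / s\<close> between
  \<open>id\<close> and \<open>id + s w\<close>, and convexity applies to their joint law. This
  replaces the limit in \<open>t\<close> by one fixed \<open>s\<close>, for all base points at
  once.\<close>

lemma secant_slope_mono:
  fixes \<nu> :: "'a::euclidean_space measure"
  assumes G: "convex_along_plans G" and \<nu>: "\<nu> \<in> P2" and w: "w \<in> C1" and t: "0 < t" "t \<le> s"
  shows "(G (distr \<nu> borel (\<lambda>x. x + t *\<^sub>R w x)) - G \<nu>) / t
    \<le> (G (distr \<nu> borel (\<lambda>x. x + s *\<^sub>R w x)) - G \<nu>) / s"
proof -
  have p: "prob_space \<nu>" "square_integrable \<nu> (\<lambda>x. x)" "sets \<nu> = sets borel"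
    using \<nu> by (auto simp: P2_iff)
  have id: "distr \<nu> borel (\<lambda>x. x) = \<nu>"
    using p distr_id2[of borel \<nu>] by (simp add: id_def)
  let ?S = "\<lambda>x. x + s *\<^sub>R w x"
  have "square_integrable \<nu> ?S"
    by (intro square_integrable_add square_integrable_scaleR p C1_square_integrable w \<nu>)
  from convex_along_plansD[OF G p(1,2) this, of "t / s"] t
  have "G (distr \<nu> borel (\<lambda>x. (1 - t / s) *\<^sub>R x + (t / s) *\<^sub>R ?S x))
      \<le> (1 - t / s) * G \<nu> + t / s * G (distr \<nu> borel ?S)"
    unfolding id by simp
  moreover have "(\<lambda>x. (1 - t / s) *\<^sub>R x + (t / s) *\<^sub>R ?S x) = (\<lambda>x. x + t *\<^sub>R w x)"
    using t by (auto simp: algebra_simps)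
  ultimately have "G (distr \<nu> borel (\<lambda>x. x + t *\<^sub>R w x)) - G \<nu>
      \<le> t * ((G (distr \<nu> borel ?S) - G \<nu>) / s)"
    by (simp add: algebra_simps diff_divide_distrib)
  then show ?thesis
    using t by (simp add: divide_le_eq mult.commute)
qed

lemma const_minus_in_C1: "(\<lambda>x. m - x) \<in> C1"
proof -
  have "norm (m - x) / (1 + norm x) \<le> 1 + norm m" for x
  proof -
    have "norm (m - x) \<le> norm m + norm x"
      by (rule norm_triangle_ineq4)
    also have "\<dots> \<le> (1 + norm m) * (1 + norm x)"
      by (simp add: algebra_simps)
    finally show ?thesis
      by (simp add: divide_le_eq add_pos_nonneg)
  qed
  then show ?thesis
    by (auto simp: C1_def intro!: continuous_intros bdd_aboveI2)
qed

text \<open>At \<mu> the quotient for the fixed step \<open>s\<close> is at most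
  \<open>- \<delta>\<close>. Changing the base point to \<nu>' costs at most
  \<open>s * \<delta> / 4\<close> in each of the two values of \<open>G\<close>, so
  \<open>- \<delta> / 2\<close> remains.\<close>

lemma clarke_deriv_negative:
  fixes \<mu> \<nu> :: "'a::euclidean_space measure"
  assumes \<mu>: "\<mu> \<in> P2" and G: "convex_along_plans G" and lip: "locally_Lipschitz_around G \<mu>"
    and \<nu>: "\<nu> \<in> P2" and less: "G \<nu> < G \<mu>"
  shows "clarke_deriv G \<mu> (\<lambda>x. (LINT z|\<nu>. z) - x) < 0"
proof -
  define m where "m = (LINT z|\<nu>. z)"
  obtain r L where r: "0 < r" and L: "0 \<le> L" and
    Lip: "\<And>\<nu> \<rho>. \<nu> \<in> P2 \<Longrightarrow> \<rho> \<in> P2 \<Longrightarrow> W2 \<nu> \<mu> < r \<Longrightarrow> W2 \<rho> \<mu> < r \<Longrightarrow> \<bar>G \<nu> - G \<rho>\<bar> \<le> L * W2 \<nu> \<rho>"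
    using lip unfolding locally_Lipschitz_around_def by blast
  define \<delta> where "\<delta> = G \<mu> - G \<nu>"
  have \<delta>: "0 < \<delta>" using less by (simp add: \<delta>_def)
  define V where "V = (LINT z|\<nu>. (norm (z - m))\<^sup>2)"
  define D where "D = (LINT x|\<mu>. (norm (m - x))\<^sup>2)"
  have V: "0 \<le> V" "0 \<le> D"
    by (simp_all add: V_def D_def)
  define A where "A = 2 * V + 2 * D"
  have A: "0 \<le> A" using V by (simp add: A_def)
  \<comment> \<open>Half of \<open>r\<^sup>2\<close> is spent on the displacement by
    \<open>s\<close>; the other half is reserved for the distance from \<nu>' to \<mu>.\<close>
  obtain s where s: "0 < s" "s \<le> 1" "s\<^sup>2 * A < r\<^sup>2 / 2"
  proof -
    have "((\<lambda>s. s\<^sup>2 * A) \<longlongrightarrow> 0\<^sup>2 * A) (at_right 0)"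
      by (intro tendsto_intros)
    moreover have "0\<^sup>2 * A < r\<^sup>2 / 2" using r by simp
    ultimately have "\<forall>\<^sub>F s in at_right 0. s\<^sup>2 * A < r\<^sup>2 / 2"
      by (rule order_tendstoD)
    moreover have "\<forall>\<^sub>F s in at_right (0::real). 0 < s \<and> s < 1"
      using eventually_at_right_real[of 0 "1::real"] by (simp add: greaterThanLessThan_def)
    ultimately have "\<forall>\<^sub>F s in at_right 0. s\<^sup>2 * A < r\<^sup>2 / 2 \<and> 0 < s \<and> s < 1"
      by (rule eventually_conj)
    then have "\<exists>s. s\<^sup>2 * A < r\<^sup>2 / 2 \<and> 0 < s \<and> s < 1"
      using eventually_happens[of _ "at_right (0::real)"] by fastforce
    then show ?thesis using that by force
  qed
  have small: "s\<^sup>2 * (2 * V + 2 * D) < r\<^sup>2"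
    using s(3) r zero_le_power2[of r] unfolding A_def by linarith
  let ?w = "\<lambda>x. m - x"
  let ?T = "\<lambda>x. x + s *\<^sub>R (m - x)"
  have T: "?T = (\<lambda>x. (1 - s) *\<^sub>R x + s *\<^sub>R m)"
    by (auto simp: algebra_simps)
  have GT: "G (distr \<mu> borel ?T) \<le> G \<mu> - s * \<delta>"
    using shift_to_mean[OF G \<mu> \<nu> r L Lip, of s] s small
    unfolding T m_def[symmetric] V_def[symmetric] D_def[symmetric]
    by (simp add: \<delta>_def algebra_simps)
  \<comment> \<open>The first bound keeps the image of \<nu>' under \<open>?T\<close> in the
    Lipschitz ball, the second makes each Lipschitz error at most
    \<open>s * \<delta> / 4\<close>.\<close>
  define \<rho> where "\<rho> = min (r / 2) (s * \<delta> / (4 * (L + 1)))"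
  have \<rho>: "0 < \<rho>" "\<rho> \<le> r / 2" "\<rho> \<le> s * \<delta> / (4 * (L + 1))"
    using r L s \<delta> by (simp_all only: \<rho>_def min.cobounded1 min.cobounded2) simp
  have L\<rho>: "L * \<rho> \<le> s * \<delta> / 4"
  proof -
    have "L * \<rho> \<le> (L + 1) * \<rho>" using \<rho> by simp
    also have "\<dots> \<le> (L + 1) * (s * \<delta> / (4 * (L + 1)))"
      using \<rho> L by (intro mult_left_mono) auto
    also have "\<dots> = s * \<delta> / 4" using L by (simp add: field_simps)
    finally show ?thesis .
  qed
  have \<mu>0: "W2 \<mu> \<mu> < r"
    by (rule W2_self_less[OF \<mu> r])
  have slope: "(G (distr \<nu>' borel ?T) - G \<nu>') / s \<le> - \<delta> / 2"
    if \<nu>': "\<nu>' \<in> P2" and near: "W2 \<nu>' \<mu> < \<rho>" for \<nu>'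
  proof -
    \<comment> \<open>Applying \<open>?T\<close> to both coordinates of a near-optimal plan
      multiplies its cost by \<open>(1 - s)\<^sup>2\<close>, so the images are again closer than
      \<rho>.\<close>
    obtain \<gamma> where \<gamma>: "\<gamma> \<in> couplings \<nu>' \<mu>" "(LINT z|\<gamma>. (norm (fst z - snd z))\<^sup>2) < \<rho>\<^sup>2"
      using W2_less_coupling[OF \<nu>' \<mu> near] .
    note c = coupling_distr[OF \<gamma>(1)] coupling_square_integrable[OF \<nu>' \<mu> \<gamma>(1)]
    note [measurable] = c(2,3)
    let ?Y = "\<lambda>z. ?T (fst z)" and ?U = "\<lambda>z. ?T (snd z)"
    have sq: "square_integrable \<gamma> ?Y" "square_integrable \<gamma> ?U"
      "square_integrable \<gamma> (\<lambda>z. fst z - snd z)" "square_integrable \<gamma> (\<lambda>z. m - snd z)"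
      by (intro square_integrable_add square_integrable_scaleR square_integrable_diff
          square_integrable_const c)+
    have dY: "distr \<gamma> borel ?Y = distr \<nu>' borel ?T"
      unfolding c(4)[symmetric] by (subst distr_distr) (auto simp: comp_def)
    have dU: "distr \<gamma> borel ?U = distr \<mu> borel ?T"
      unfolding c(5)[symmetric] by (subst distr_distr) (auto simp: comp_def)
    have D\<gamma>: "(LINT z|\<gamma>. (norm (m - snd z))\<^sup>2) = D"
      using integral_distr[of snd \<gamma> borel "\<lambda>x. (norm (m - x))\<^sup>2"] c by (simp add: D_def)
    have m1: "?Y z - ?U z = (1 - s) *\<^sub>R (fst z - snd z)"
      "?Y z - snd z = (1 - s) *\<^sub>R (fst z - snd z) + s *\<^sub>R (m - snd z)"
      "?U z - snd z = s *\<^sub>R (m - snd z)" for z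
      by (auto simp: algebra_simps)
    have s1: "(1 - s)\<^sup>2 \<le> 1"
      using s by (simp add: power_le_one)
    have contr: "(LINT z|\<gamma>. (norm ((1 - s) *\<^sub>R (fst z - snd z)))\<^sup>2) < \<rho>\<^sup>2"
    proof -
      have "(LINT z|\<gamma>. (norm ((1 - s) *\<^sub>R (fst z - snd z)))\<^sup>2)
          = (1 - s)\<^sup>2 * (LINT z|\<gamma>. (norm (fst z - snd z))\<^sup>2)"
        by (simp add: power_mult_distrib)
      also have "\<dots> \<le> 1 * (LINT z|\<gamma>. (norm (fst z - snd z))\<^sup>2)"
        using s1 by (intro mult_right_mono) auto
      finally show ?thesis using \<gamma>(2) by simp
    qed
    have sD: "(LINT z|\<gamma>. (norm (s *\<^sub>R (m - snd z)))\<^sup>2) = s\<^sup>2 * D"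
      by (simp add: power_mult_distrib D\<gamma>)
    have sA: "2 * (s\<^sup>2 * D) \<le> s\<^sup>2 * A"
      using V by (simp add: A_def algebra_simps)
    have "\<rho>\<^sup>2 \<le> (r / 2)\<^sup>2"
      using \<rho> by (intro power_mono) auto
    then have \<rho>r: "2 * \<rho>\<^sup>2 \<le> r\<^sup>2 / 2"
      by (simp add: power_divide)
    have YU: "W2 (distr \<gamma> borel ?Y) (distr \<gamma> borel ?U) < \<rho>"
      using W2_distr_less[OF c(1) sq(1,2)[THEN square_integrable_measurable], of \<rho>] contr \<rho>
      unfolding m1 by auto
    have "(LINT z|\<gamma>. (norm (?Y z - snd z))\<^sup>2) < r\<^sup>2"
      using integral_norm_add_squared_le[OF square_integrable_scaleR[OF sq(3), of "1 - s"]
          square_integrable_scaleR[OF sq(4), of s]] contr sA s(3) \<rho>r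
      unfolding m1 sD by linarith
    then have Y\<mu>: "W2 (distr \<gamma> borel ?Y) \<mu> < r"
      using W2_distr_less[OF c(1) sq(1)[THEN square_integrable_measurable] c(3)] r
      unfolding c(5) by auto
    have "(LINT z|\<gamma>. (norm (?U z - snd z))\<^sup>2) < r\<^sup>2"
      using sA s(3) zero_le_power2[of r] V mult_nonneg_nonneg[of "s\<^sup>2" D] small
      unfolding m1 sD A_def by linarith
    then have U\<mu>: "W2 (distr \<gamma> borel ?U) \<mu> < r"
      using W2_distr_less[OF c(1) sq(2)[THEN square_integrable_measurable] c(3)] r
      unfolding c(5) by auto
    have "\<bar>G (distr \<gamma> borel ?Y) - G (distr \<gamma> borel ?U)\<bar>
        \<le> L * W2 (distr \<gamma> borel ?Y) (distr \<gamma> borel ?U)"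
      by (intro Lip distr_in_P2 c sq Y\<mu> U\<mu>)
    also have "\<dots> \<le> L * \<rho>"
      using YU L by (intro mult_left_mono) auto
    finally have 1: "G (distr \<nu>' borel ?T) \<le> G (distr \<mu> borel ?T) + L * \<rho>"
      unfolding dY dU by linarith
    have "\<bar>G \<nu>' - G \<mu>\<bar> \<le> L * W2 \<nu>' \<mu>"
      using near \<rho> r \<mu>0 by (intro Lip \<mu> \<nu>') auto
    also have "\<dots> \<le> L * \<rho>"
      using near L by (intro mult_left_mono) auto
    finally have "G (distr \<nu>' borel ?T) - G \<nu>' \<le> - (s * \<delta>) / 2"
      using 1 GT L\<rho> by linarith
    then show ?thesis
      using s by (simp add: divide_le_eq algebra_simps)
  qed
  \<comment> \<open>For \<nu>' in this ball and \<open>0 < t < s\<close>, the quotient at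
    \<open>t\<close> is at most the one at \<open>s\<close>, which \<open>slope\<close>
    bounds.\<close>
  have "\<forall>\<^sub>F \<nu>' in nhds_W2 \<mu>. \<nu>' \<in> P2 \<and> W2 \<nu>' \<mu> < \<rho>"
    unfolding nhds_W2_def using \<rho> by (intro eventually_INF1[of \<rho>]) (auto simp: eventually_principal)
  moreover have "\<forall>\<^sub>F t in at_right 0. 0 < t \<and> t < s"
    using eventually_at_right_real[OF s(1)] by (simp add: greaterThanLessThan_def)
  ultimately have "\<forall>\<^sub>F x in nhds_W2 \<mu> \<times>\<^sub>F at_right 0.
      (case x of (\<nu>', t) \<Rightarrow> ereal ((G (distr \<nu>' borel (\<lambda>x. x + t *\<^sub>R ?w x)) - G \<nu>') / t)) \<le> ereal (- \<delta> / 2)"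
    unfolding eventually_prod_filter
    using order_trans[OF secant_slope_mono[OF G _ const_minus_in_C1] slope] by fastforce
  then have "clarke_deriv G \<mu> ?w \<le> ereal (- \<delta> / 2)"
    unfolding clarke_deriv_def by (rule Limsup_bounded)
  also have "\<dots> < 0"
    using \<delta> by (simp add: zero_ereal_def)
  finally show ?thesis
    by (simp add: m_def)
qed

theorem corollary4p11:
  fixes G :: "'a::euclidean_space measure \<Rightarrow> real" and \<mu> :: "'a measure"
  assumes "\<mu> \<in> P2"
    and "convex_along_plans G"
    and "locally_Lipschitz_around G \<mu>"
  shows "\<mu> \<in> argmin G \<longleftrightarrow> (\<lambda>_. 0) \<in> clarke_subdiff G \<mu>"
proof
  assume "\<mu> \<in> argmin G"
  \<comment> \<open>The zero map pairs to 0 with every test map, so membership amounts to a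
    nonnegative Clarke derivative in all directions of \<open>C1\<close>.\<close>
  then show "(\<lambda>_. 0) \<in> clarke_subdiff G \<mu>"
    using clarke_deriv_nonneg_of_argmin[OF assms(1)]
    by (auto simp: clarke_subdiff_def L2_def inner_L2_def zero_ereal_def)
next
  assume zero: "(\<lambda>_. 0) \<in> clarke_subdiff G \<mu>"
  show "\<mu> \<in> argmin G"
  proof (rule ccontr)
    assume "\<mu> \<notin> argmin G"
    then obtain \<nu> where \<nu>: "\<nu> \<in> P2" "G \<nu> < G \<mu>"
      using assms(1) by (auto simp: argmin_def is_arg_min_def)
    have "0 \<le> clarke_deriv G \<mu> (\<lambda>x. (LINT z|\<nu>. z) - x)"
      using zero const_minus_in_C1
      by (auto simp: clarke_subdiff_def inner_L2_def zero_ereal_def)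
    with clarke_deriv_negative[OF assms \<nu>] show False
      by simp
  qed
qed

end
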